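(* Let $n\ge 1$. For $1\le k\le n$ let $h_k:=e_{k,k}-\frac{1}{n+1}\sum_{m=1}^{n+1}e_{m,m}\in\mathfrak{sl}_{n+1}(\mathbb{C})$. Then for each $b\in\mathbb{C}$ the vector space $\mathbb{C}[h_1,\ldots,h_n]$ is a simple $\mathfrak{sl}_{n+1}(\mathbb{C})$-module under the action $$h_i\cdot f(h_1,\ldots,h_n)=h_i f(h_1,\ldots,h_n)\qquad (1\le i\le n),$$ $$e_{i,n+1}\cdot f(h_1,\ldots,h_n)=\Big(b+\sum_{m=1}^n h_m\Big)(h_i-b-1)\,f(h_1,\ldots,h_i-1,\ldots,h_n)\qquad(1\le i\le n),$$ $$e_{n+1,j}\cdot f(h_1,\ldots,h_n)=-f(h_1,\ldots,h_j+1,\ldots,h_n)\qquad(1\le j\le n),$$ $$e_{i,j}\cdot f(h_1,\ldots,h_n)=(h_i-b-1)\,f(h_1,\ldots,h_i-1,\ldots,h_j+1,\ldots,h_n)\qquad(1\le i,j\le n,\ i\ne j).$$ Moreover, for $n>1$, different choices of $b$ give nonisomorphic modules.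
   Context: $\mathfrak{sl}_{n+1}(\mathbb{C})$ is the Lie algebra of trace-zero complex $(n+1)\times(n+1)$ matrices with bracket $[x,y]=xy-yx$, and $e_{i,j}$ denotes the matrix units. The elements $h_1,\ldots,h_n$ together with the $e_{i,j}$, $i\neq j$, $1\le i,j\le n+1$, form a basis of $\mathfrak{sl}_{n+1}(\mathbb{C})$. In the formulas, unmentioned variables are left unchanged; in the last formula $h_i$ is replaced by $h_i-1$ and $h_j$ by $h_j+1$. *)

theory Defs
  imports "HOL-Analysis.Analysis" "HOL-Library.Poly_Mapping"
begin

section \<open>Matrix Lie algebras and their modules\<close>

definition matrix_scale :: "complex \<Rightarrow> complex^'m^'m \<Rightarrow> complex^'m^'m" where
  "matrix_scale c x = (\<chi> i j. c * x $ i $ j)"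

definition lie_bracket :: "complex^'m^'m \<Rightarrow> complex^'m^'m \<Rightarrow> complex^'m^'m" where
  "lie_bracket x y = x ** y - y ** x"

definition sl :: "(complex^'m^'m) set" where
  "sl = {x. trace x = 0}"

text \<open>
  A module over a complex Lie algebra \<open>L\<close> of matrices is carried by a whole type \<open>'v\<close> with
  scalar multiplication \<open>smul\<close>; only the values of the action \<open>\<rho>\<close> on \<open>L\<close> matter. That \<open>'v\<close> is a
  complex vector space is part of the predicate \<^const>\<open>Vector_Spaces.linear\<close>.
\<close>

definition lie_module ::
  "(complex^'m^'m) set \<Rightarrow> (complex \<Rightarrow> 'v::ab_group_add \<Rightarrow> 'v) \<Rightarrow> (complex^'m^'m \<Rightarrow> 'v \<Rightarrow> 'v) \<Rightarrow> bool"
where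
  "lie_module L smul \<rho> \<longleftrightarrow>
     (\<forall>x\<in>L. Vector_Spaces.linear smul smul (\<rho> x)) \<and>
     (\<forall>x\<in>L. \<forall>y\<in>L. \<forall>v. \<rho> (x + y) v = \<rho> x v + \<rho> y v) \<and>
     (\<forall>c. \<forall>x\<in>L. \<forall>v. \<rho> (matrix_scale c x) v = smul c (\<rho> x v)) \<and>
     (\<forall>x\<in>L. \<forall>y\<in>L. \<forall>v. \<rho> (lie_bracket x y) v = \<rho> x (\<rho> y v) - \<rho> y (\<rho> x v))"

definition lie_submodule ::
  "(complex^'m^'m) set \<Rightarrow> (complex \<Rightarrow> 'v::ab_group_add \<Rightarrow> 'v) \<Rightarrow> (complex^'m^'m \<Rightarrow> 'v \<Rightarrow> 'v) \<Rightarrow>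
   'v set \<Rightarrow> bool"
where
  "lie_submodule L smul \<rho> W \<longleftrightarrow> module.subspace smul W \<and> (\<forall>x\<in>L. \<forall>w\<in>W. \<rho> x w \<in> W)"

definition simple_lie_module ::
  "(complex^'m^'m) set \<Rightarrow> (complex \<Rightarrow> 'v::ab_group_add \<Rightarrow> 'v) \<Rightarrow> (complex^'m^'m \<Rightarrow> 'v \<Rightarrow> 'v) \<Rightarrow> bool"
where
  "simple_lie_module L smul \<rho> \<longleftrightarrow>
     lie_module L smul \<rho> \<and> (UNIV :: 'v set) \<noteq> {0} \<and>
     (\<forall>W. lie_submodule L smul \<rho> W \<longrightarrow> W = {0} \<or> W = UNIV)"

definition lie_module_isomorphic ::
  "(complex^'m^'m) set \<Rightarrow>
   (complex \<Rightarrow> 'v::ab_group_add \<Rightarrow> 'v) \<Rightarrow> (complex^'m^'m \<Rightarrow> 'v \<Rightarrow> 'v) \<Rightarrow>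
   (complex \<Rightarrow> 'w::ab_group_add \<Rightarrow> 'w) \<Rightarrow> (complex^'m^'m \<Rightarrow> 'w \<Rightarrow> 'w) \<Rightarrow> bool"
where
  "lie_module_isomorphic L smul \<rho> smul' \<rho>' \<longleftrightarrow>
     (\<exists>\<phi>. Vector_Spaces.linear smul smul' \<phi> \<and> bij \<phi> \<and>
          (\<forall>x\<in>L. \<forall>v. \<phi> (\<rho> x v) = \<rho>' x (\<phi> v)))"


section \<open>Polynomials in finitely many variables\<close>

text \<open>
  A monomial is its exponent function and a polynomial is a finitely supported family of
  coefficients indexed by monomials; the product on \<open>'n poly_ring\<close> is the convolution product.
  The variables \<open>h\<^sub>1, \<dots>, h\<^sub>n\<close> are indexed by the finite type \<open>'n\<close>, so \<open>n = CARD('n) \<ge> 1\<close>.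
\<close>

type_synonym 'n poly_ring = "('n \<Rightarrow>\<^sub>0 nat) \<Rightarrow>\<^sub>0 complex"

definition pconst :: "complex \<Rightarrow> 'n poly_ring" where
  "pconst c = Poly_Mapping.single 0 c"

definition pvar :: "'n \<Rightarrow> 'n poly_ring" where
  "pvar i = Poly_Mapping.single (Poly_Mapping.single i 1) 1"

definition pscale :: "complex \<Rightarrow> 'n poly_ring \<Rightarrow> 'n poly_ring" where
  "pscale c f = pconst c * f"

definition psubst :: "('n::finite \<Rightarrow> 'n poly_ring) \<Rightarrow> 'n poly_ring \<Rightarrow> 'n poly_ring" where
  "psubst \<sigma> f = (\<Sum>m\<in>Poly_Mapping.keys f.
      pconst (Poly_Mapping.lookup f m) * (\<Prod>i\<in>UNIV. \<sigma> i ^ Poly_Mapping.lookup m i))"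


section \<open>The action of the special linear Lie algebra on the polynomial ring\<close>

text \<open>
  The \<open>n + 1\<close> row and column indices are the elements of \<open>'n option\<close>: \<open>Some i\<close> stands for
  \<open>i \<le> n\<close> and \<open>None\<close> for \<open>n + 1\<close>.
\<close>

definition matrix_unit :: "'m::finite \<Rightarrow> 'm \<Rightarrow> complex^'m^'m" where
  "matrix_unit i j = axis i (axis j 1)"

definition cartan_h :: "'n::finite \<Rightarrow> complex^('n option)^('n option)" where
  "cartan_h k = matrix_unit (Some k) (Some k)
     - matrix_scale (1 / of_nat (CARD('n) + 1)) (\<Sum>m\<in>UNIV. matrix_unit m m)"

fun unit_action :: "complex \<Rightarrow> 'n::finite option \<Rightarrow> 'n option \<Rightarrow> 'n poly_ring \<Rightarrow> 'n poly_ring" where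
  "unit_action b (Some i) None f =
     (pconst b + (\<Sum>m\<in>UNIV. pvar m)) * (pvar i - pconst b - 1) * psubst (pvar(i := pvar i - 1)) f"
| "unit_action b None (Some j) f = - psubst (pvar(j := pvar j + 1)) f"
| "unit_action b (Some i) (Some j) f =
     (pvar i - pconst b - 1) * psubst (pvar(i := pvar i - 1, j := pvar j + 1)) f"
| "unit_action b None None f = 0"

text \<open>
  The last equation, and the third one for \<open>i = j\<close>, are never used below. The linear extension
  from the basis \<open>cartan_h k\<close>, \<open>matrix_unit i j\<close> (\<open>i \<noteq> j\<close>) is written with the coordinates of
  \<open>x \<in> sl\<close> in that basis, as computed in lemma \<open>sl_basis_expansion\<close>.
\<close>

definition sl_action ::
  "complex \<Rightarrow> complex^('n::finite option)^('n option) \<Rightarrow> 'n poly_ring \<Rightarrow> 'n poly_ring"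
where
  "sl_action b x f =
     (\<Sum>k\<in>UNIV. pscale (x $ Some k $ Some k - x $ None $ None) (pvar k * f)) +
     (\<Sum>(i, j) \<in> {(i, j). i \<noteq> j}. pscale (x $ i $ j) (unit_action b i j f))"

lemma lie_bracket_in_sl: "lie_bracket x y \<in> sl"
  unfolding lie_bracket_def sl_def mem_Collect_eq trace_sub
  by (subst trace_mul_sym) (rule diff_self)

lemma matrix_unit_nth: "matrix_unit i j $ k $ l = (if k = i \<and> l = j then 1 else 0)"
  by (auto simp: matrix_unit_def axis_def)

lemma matrix_unit_in_sl: "i \<noteq> j \<Longrightarrow> matrix_unit i j \<in> sl"
  unfolding sl_def trace_def mem_Collect_eq
  by (rule sum.neutral) (auto simp: matrix_unit_nth)

lemma cartan_h_nth:
  "cartan_h (k :: 'n::finite) $ i $ j =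
     (if i = Some k \<and> j = Some k then 1 else 0) -
     (if i = j then 1 / of_nat (CARD('n) + 1) else 0)"
proof -
  have "(\<Sum>m\<in>(UNIV :: 'n option set). matrix_unit m m) $ i $ j = (if i = j then 1 else 0)"
  proof -
    have "(\<Sum>m\<in>(UNIV :: 'n option set). matrix_unit m m) $ i $ j =
        (\<Sum>m\<in>UNIV. if m = i then (if i = j then 1 else 0) else 0)"
      unfolding sum_component by (intro sum.cong) (auto simp: matrix_unit_nth)
    then show ?thesis
      by simp
  qed
  then show ?thesis
    by (auto simp: cartan_h_def matrix_scale_def matrix_unit_nth)
qed

lemma cartan_h_in_sl: "cartan_h (k :: 'n::finite) \<in> sl"
proof -
  have "(of_nat (CARD('n) + 1) :: complex) \<noteq> 0"
    by (simp only: of_nat_eq_0_iff)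
  then show ?thesis
    by (simp add: sl_def trace_def cartan_h_nth sum_subtractf)
qed

lemma sl_basis_expansion:
  fixes x :: "complex^('n::finite option)^('n option)"
  assumes "x \<in> sl"
  shows "x = (\<Sum>k\<in>UNIV. matrix_scale (x $ Some k $ Some k - x $ None $ None) (cartan_h k)) +
             (\<Sum>(i, j) \<in> {(i, j). i \<noteq> j}. matrix_scale (x $ i $ j) (matrix_unit i j))"
    (is "x = ?D + ?O")
proof -
  have N: "(of_nat (CARD('n) + 1) :: complex) \<noteq> 0"
    by (simp only: of_nat_eq_0_iff)
  have tr: "x $ None $ None + (\<Sum>k\<in>UNIV. x $ Some k $ Some k) = 0"
    using assms by (simp add: sl_def trace_def UNIV_option_conv sum.reindex)
  have O: "?O $ i $ j = (if i = j then 0 else x $ i $ j)" for i j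
  proof -
    have "?O $ i $ j = (\<Sum>p\<in>{(i, j). i \<noteq> j}. if p = (i, j) then x $ i $ j else 0)"
      unfolding sum_component
      by (intro sum.cong) (auto simp: matrix_scale_def matrix_unit_nth split: if_splits)
    then show ?thesis
      by simp
  qed
  have D: "?D $ i $ j = (if i = j then x $ i $ j else 0)" for i j
  proof -
    let ?c = "x $ None $ None" and ?N = "of_nat (CARD('n) + 1) :: complex"
    have "(\<Sum>k\<in>UNIV. (x $ Some k $ Some k - ?c) / ?N)
        = ((\<Sum>k\<in>UNIV. x $ Some k $ Some k) - of_nat CARD('n) * ?c) / ?N"
      by (simp only: sum_divide_distrib[symmetric] sum_subtractf sum_constant)
    also have "(\<Sum>k\<in>UNIV. x $ Some k $ Some k) = - ?c"
      using tr by (metis add.inverse_unique)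
    also have "- ?c - of_nat CARD('n) * ?c = (- ?c) * ?N"
      by (simp add: algebra_simps)
    also have "(- ?c) * ?N / ?N = - ?c"
      using N by (rule nonzero_mult_div_cancel_right)
    finally have S: "(\<Sum>k\<in>UNIV. (x $ Some k $ Some k - ?c) / ?N) = - ?c" .
    show ?thesis
    proof (cases "i = j")
      case False
      then show ?thesis
        by (auto simp: matrix_scale_def cartan_h_nth intro!: sum.neutral)
    next
      case True
      have "?D $ i $ j = (\<Sum>k\<in>UNIV. if i = Some k then x $ Some k $ Some k - x $ None $ None else 0)
        - (\<Sum>k\<in>UNIV. (x $ Some k $ Some k - x $ None $ None) / of_nat (CARD('n) + 1))"
        unfolding sum_component sum_subtractf[symmetric] using True
        by (intro sum.cong) (auto simp: matrix_scale_def cartan_h_nth algebra_simps diff_divide_distrib)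
      then show ?thesis
        unfolding S using True by (cases i) auto
    qed
  qed
  show ?thesis
    unfolding vec_eq_iff
  proof (intro allI)
    fix i j
    show "x $ i $ j = (?D + ?O) $ i $ j"
      unfolding vector_add_component D O by simp
  qed
qed

end

theory Submission
  imports Defs
begin

text \<open>
  Up to a scalar multiple of the trace, which vanishes on \<open>sl\<close>, the matrix unit \<open>e\<^sub>i\<^sub>j\<close> (diagonal
  ones included) acts as \<open>P\<^sub>i Q\<^sub>j\<close>, where \<open>P\<^sub>i\<close> is the downward shift in \<open>h\<^sub>i\<close> followed by
  multiplication by \<open>h\<^sub>i - b - 1\<close>, \<open>Q\<^sub>j\<close> is the upward shift in \<open>h\<^sub>j\<close>, and for the last index
  \<open>P = -1\<close> and \<open>Q\<close> is multiplication by \<open>b + h\<^sub>1 + \<dots> + h\<^sub>n + 1\<close>. The commutation relations of these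
  operators, almost those of a Weyl algebra, give the bracket relations of \<open>gl\<close> at once.

  A submodule is an ideal closed under the upward shifts. If \<open>f\<close> is not constant, some difference
  \<open>f(h\<^sub>i + 1) - f\<close> is nonzero and of smaller degree, so a nonzero submodule contains \<open>1\<close> and hence
  everything. An isomorphism \<open>\<phi>\<close> commutes with multiplication by polynomials and with the shifts, so
  \<open>\<phi> 1\<close> is shift invariant; the action of any \<open>e\<^sub>i\<^sub>j\<close>, \<open>i \<noteq> j \<le> n\<close>, on \<open>1\<close> then forces
  \<open>(b' - b) \<phi> 1 = 0\<close>.
\<close>

subsection \<open>Substitutions and shifts\<close>

lemma pconst_add: "pconst (a + b) = pconst a + pconst b"
  by (simp add: pconst_def single_add)

lemma pconst_mult: "pconst (a * b) = pconst a * pconst b"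
  by (simp add: pconst_def mult_single)

lemma pconst_uminus: "pconst (- a) = - pconst a"
  by (simp add: pconst_def single_uminus)

lemma pconst_diff: "pconst (a - b) = pconst a - pconst b"
  by (simp add: pconst_def single_diff)

lemma pconst_0 [simp]: "pconst 0 = 0"
  by (simp add: pconst_def)

lemma pconst_1 [simp]: "pconst 1 = 1"
  by (simp add: pconst_def)

lemma pconst_sum: "pconst (\<Sum>i\<in>A. c i) = (\<Sum>i\<in>A. pconst (c i))"
  by (induction A rule: infinite_finite_induct) (simp_all add: pconst_add)

lemma single_power: "Poly_Mapping.single m (c :: complex) ^ k = Poly_Mapping.single (\<Sum>_<k. m) (c ^ k)"
  by (induction k) (simp_all add: mult_single add.commute)

lemma single_prod:
  "finite A \<Longrightarrow> (\<Prod>i\<in>A. Poly_Mapping.single (m i) (c i :: complex)) = Poly_Mapping.single (\<Sum>i\<in>A. m i) (\<Prod>i\<in>A. c i)"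
  by (induction rule: finite_induct) (simp_all add: mult_single)

lemma prod_pvar_power:
  "(\<Prod>i\<in>UNIV. pvar i ^ Poly_Mapping.lookup m i) = (Poly_Mapping.single m 1 :: 'n::finite poly_ring)"
proof -
  have "(\<Sum>i\<in>UNIV. \<Sum>_<Poly_Mapping.lookup m i. Poly_Mapping.single i (1::nat)) = m"
    by (rule poly_mapping_eqI) (simp add: lookup_sum lookup_single when_def if_distrib cong: if_cong)
  then show ?thesis
    by (simp add: pvar_def single_power single_prod)
qed

lemma poly_expansion:
  "f = (\<Sum>m\<in>Poly_Mapping.keys f. Poly_Mapping.single m (Poly_Mapping.lookup f m))"
  by (rule poly_mapping_eqI) (auto simp: lookup_sum lookup_single when_def in_keys_iff)

text \<open>Constants and variables generate the ring. Identities between operators that respect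
  sums and products thus need checking on generators only.\<close>

lemma poly_ring_induct [case_names const var add mult]:
  fixes f :: "'n::finite poly_ring"
  assumes const: "\<And>c. P (pconst c)"
    and var: "\<And>i. P (pvar i)"
    and add: "\<And>f g. P f \<Longrightarrow> P g \<Longrightarrow> P (f + g)"
    and mult: "\<And>f g. P f \<Longrightarrow> P g \<Longrightarrow> P (f * g)"
  shows "P f"
proof -
  have one: "P 1" and zero: "P 0"
    using const[of 1] const[of 0] by simp_all
  have power: "P g \<Longrightarrow> P (g ^ k)" for g and k :: nat
    by (induction k) (auto intro: mult one)
  have "P (\<Prod>i\<in>A. pvar i ^ Poly_Mapping.lookup m i)" for m :: "'n \<Rightarrow>\<^sub>0 nat" and A
    by (induction A rule: infinite_finite_induct) (auto intro: mult one power var)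
  then have "P (Poly_Mapping.single m 1)" for m
    by (metis prod_pvar_power)
  then have "P (pconst c * Poly_Mapping.single m 1)" for c m
    by (intro mult const)
  then have single: "P (Poly_Mapping.single m c)" for c m
    by (simp add: pconst_def mult_single)
  have "P (\<Sum>m\<in>A. Poly_Mapping.single m (Poly_Mapping.lookup f m))" for A
    by (induction A rule: infinite_finite_induct) (auto intro: add zero single)
  then show ?thesis
    by (metis poly_expansion)
qed

section \<open>Substitution as a ring homomorphism\<close>

lemma psubst_superset:
  assumes "finite A" "Poly_Mapping.keys f \<subseteq> A"
  shows "psubst \<sigma> f = (\<Sum>m\<in>A. pconst (Poly_Mapping.lookup f m) * (\<Prod>i\<in>UNIV. \<sigma> i ^ Poly_Mapping.lookup m i))"
  unfolding psubst_def using assms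
  by (intro sum.mono_neutral_left) (auto simp: in_keys_iff)

lemma psubst_single:
  "psubst \<sigma> (Poly_Mapping.single m c) = pconst c * (\<Prod>i\<in>UNIV. \<sigma> i ^ Poly_Mapping.lookup m i)"
  by (subst psubst_superset[of "{m}"]) auto

lemma psubst_add: "psubst \<sigma> (f + g) = psubst \<sigma> f + psubst \<sigma> g"
proof -
  let ?A = "Poly_Mapping.keys f \<union> Poly_Mapping.keys g"
  have "Poly_Mapping.keys (f + g) \<subseteq> ?A"
    by (rule keys_add)
  then show ?thesis
    by (simp add: psubst_superset[of ?A] lookup_add pconst_add distrib_right sum.distrib)
qed

lemma psubst_0 [simp]: "psubst \<sigma> 0 = 0"
  by (simp add: psubst_def)

lemma psubst_sum: "psubst \<sigma> (\<Sum>a\<in>A. f a) = (\<Sum>a\<in>A. psubst \<sigma> (f a))"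
  by (induction A rule: infinite_finite_induct) (simp_all add: psubst_add)

lemma psubst_pconst [simp]: "psubst \<sigma> (pconst c) = pconst c"
  by (simp add: pconst_def psubst_single)

lemma psubst_1 [simp]: "psubst \<sigma> 1 = 1"
  using psubst_pconst[of \<sigma> 1] by simp

lemma psubst_pvar [simp]: "psubst \<sigma> (pvar i) = \<sigma> i"
proof -
  have "(\<Prod>j\<in>UNIV. \<sigma> j ^ Poly_Mapping.lookup (Poly_Mapping.single i 1) j) = (\<Prod>j\<in>UNIV. if j = i then \<sigma> j else 1)"
    by (intro prod.cong) (auto simp: lookup_single)
  then show ?thesis
    by (simp add: pvar_def psubst_single)
qed

text \<open>On monomials this is the law of exponents; expanding both factors into monomials and
  using additivity gives the rest.\<close>

lemma psubst_mult: "psubst \<sigma> (f * g) = psubst \<sigma> f * psubst \<sigma> g"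
proof -
  have *: "psubst \<sigma> (Poly_Mapping.single m c * Poly_Mapping.single l d) =
      psubst \<sigma> (Poly_Mapping.single m c) * psubst \<sigma> (Poly_Mapping.single l d)" for m c l d
    by (simp add: mult_single psubst_single lookup_add power_add prod.distrib pconst_mult mult.commute mult.left_commute)
  have "psubst \<sigma> (f * g) =
      psubst \<sigma> ((\<Sum>m\<in>Poly_Mapping.keys f. Poly_Mapping.single m (Poly_Mapping.lookup f m)) *
                (\<Sum>m\<in>Poly_Mapping.keys g. Poly_Mapping.single m (Poly_Mapping.lookup g m)))"
    by (simp only: poly_expansion[symmetric])
  also have "\<dots> = psubst \<sigma> (\<Sum>m\<in>Poly_Mapping.keys f. Poly_Mapping.single m (Poly_Mapping.lookup f m)) *
                   psubst \<sigma> (\<Sum>m\<in>Poly_Mapping.keys g. Poly_Mapping.single m (Poly_Mapping.lookup g m))"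
    by (simp only: sum_product psubst_sum *)
  finally show ?thesis
    by (simp only: poly_expansion[symmetric])
qed

lemma psubst_uminus: "psubst \<sigma> (- f) = - psubst \<sigma> f"
  by (rule add_eq_0_iff[THEN iffD1]) (simp flip: psubst_add)

lemma psubst_diff: "psubst \<sigma> (f - g) = psubst \<sigma> f - psubst \<sigma> g"
  using psubst_add[of \<sigma> f "- g"] by (simp add: psubst_uminus)

lemmas psubst_hom = psubst_add psubst_mult psubst_diff psubst_uminus psubst_sum

section \<open>The shift operators\<close>

definition up :: "'n::finite \<Rightarrow> 'n poly_ring \<Rightarrow> 'n poly_ring" where
  "up i = psubst (pvar(i := pvar i + 1))"

definition down :: "'n::finite \<Rightarrow> 'n poly_ring \<Rightarrow> 'n poly_ring" where
  "down i = psubst (pvar(i := pvar i - 1))"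

lemma shift_hom:
  "up i (f + g) = up i f + up i g" "down i (f + g) = down i f + down i g"
  "up i (f * g) = up i f * up i g" "down i (f * g) = down i f * down i g"
  "up i (f - g) = up i f - up i g" "down i (f - g) = down i f - down i g"
  "up i (- f) = - up i f" "down i (- f) = - down i f"
  "up i (pconst c) = pconst c" "down i (pconst c) = pconst c"
  "up i 1 = 1" "down i 1 = 1" "up i 0 = 0" "down i 0 = 0"
  by (simp_all add: up_def down_def psubst_hom)

lemma shift_pvar:
  "up i (pvar j) = (if j = i then pvar j + 1 else pvar j)"
  "down i (pvar j) = (if j = i then pvar j - 1 else pvar j)"
  by (simp_all add: up_def down_def)

lemma shift_sum_pvar:
  "up i (\<Sum>m\<in>UNIV. pvar m) = (\<Sum>m\<in>UNIV. pvar m) + 1"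
  "down i (\<Sum>m\<in>UNIV. pvar m) = (\<Sum>m\<in>UNIV. pvar m) - 1"
  by (simp_all add: up_def down_def sum.remove[of UNIV i] psubst_hom)

lemma shift_commute:
  "up i (up j f) = up j (up i f)" "down i (down j f) = down j (down i f)"
  "up i (down j f) = down j (up i f)"
  by (induction f rule: poly_ring_induct; simp add: shift_hom shift_pvar)+

lemma shift_inverse: "up i (down i f) = f" "down i (up i f) = f"
  by (induction f rule: poly_ring_induct; simp add: shift_hom shift_pvar)+

lemma psubst_shift_two:
  "i \<noteq> j \<Longrightarrow> psubst (pvar(i := pvar i - 1, j := pvar j + 1)) f = down i (up j f)"
  by (induction f rule: poly_ring_induct) (simp_all add: shift_hom shift_pvar psubst_hom)

subsection \<open>The module axioms\<close>

text \<open>On the indices \<open>Some i\<close> these behave like creation and annihilation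
  operators of a Weyl algebra. The summand 1 in \<open>anni b None\<close> is absorbed by the
  downward shift of \<open>crea b (Some i)\<close>, which lowers the sum of all variables by one;
  what remains is the factor prescribed for the last column.\<close>

fun crea :: "complex \<Rightarrow> 'n::finite option \<Rightarrow> 'n poly_ring \<Rightarrow> 'n poly_ring" where
  "crea b None f = - f"
| "crea b (Some i) f = (pvar i - pconst b - 1) * down i f"

fun anni :: "complex \<Rightarrow> 'n::finite option \<Rightarrow> 'n poly_ring \<Rightarrow> 'n poly_ring" where
  "anni b None f = (pconst b + (\<Sum>m\<in>UNIV. pvar m) + 1) * f"
| "anni b (Some j) f = up j f"

lemma crea_linear:
  "crea b i (f + g) = crea b i f + crea b i g"
  "crea b i (f - g) = crea b i f - crea b i g"
  "crea b i (- f) = - crea b i f"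
  "crea b i (pconst c * f) = pconst c * crea b i f"
  "crea b i 0 = 0"
  by (cases i; simp add: shift_hom algebra_simps)+

lemma anni_linear:
  "anni b i (f + g) = anni b i f + anni b i g"
  "anni b i (f - g) = anni b i f - anni b i g"
  "anni b i (- f) = - anni b i f"
  "anni b i (pconst c * f) = pconst c * anni b i f"
  "anni b i 0 = 0"
  by (cases i; simp add: shift_hom algebra_simps)+

lemma crea_sum: "crea b i (\<Sum>a\<in>A. F a) = (\<Sum>a\<in>A. crea b i (F a))"
  by (induction A rule: infinite_finite_induct) (simp_all add: crea_linear)

lemma anni_sum: "anni b i (\<Sum>a\<in>A. F a) = (\<Sum>a\<in>A. anni b i (F a))"
  by (induction A rule: infinite_finite_induct) (simp_all add: anni_linear)

lemma crea_crea: "crea b i (crea b k f) = crea b k (crea b i f)"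
  by (cases i; cases k; simp add: shift_hom shift_pvar shift_commute algebra_simps)

text \<open>A shift in one variable changes both that variable and the sum of all variables by one.
  This produces the correction for \<open>j = k\<close> and the one for
  \<open>j = None\<close>.\<close>

lemma anni_crea:
  "anni b j (crea b k f) = crea b k (anni b j f) +
     (if k = None then 0 else if j = None then crea b k f else if j = k then f else 0)"
  by (cases j; cases k; auto simp: shift_hom shift_pvar shift_sum_pvar shift_commute shift_inverse algebra_simps)

lemma anni_anni:
  "anni b j (anni b l f) = anni b l (anni b j f) +
     (if j = None \<and> l \<noteq> None then - anni b l f else if j \<noteq> None \<and> l = None then anni b j f else 0)"
  by (cases j; cases l; auto simp: shift_hom shift_sum_pvar shift_commute algebra_simps)

text \<open>This is the relation [e_ij, e_kl] = delta_jk e_il - delta_li e_kj of the matrix units of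
  gl, diagonal ones included.\<close>

lemma crea_anni_bracket:
  "crea b i (anni b j (crea b k (anni b l f))) - crea b k (anni b l (crea b i (anni b j f))) =
     (if j = k then crea b i (anni b l f) else 0) - (if l = i then crea b k (anni b j f) else 0)"
proof -
  \<comment> \<open>Both products are brought to the order creators before annihilators. The first
    two corrections come from moving an annihilator past a creator, the third from exchanging the
    two annihilators.\<close>
  have "crea b i (anni b j (crea b k (anni b l f))) - crea b k (anni b l (crea b i (anni b j f))) =
     crea b i (if k = None then 0 else if j = None then crea b k (anni b l f) else if j = k then anni b l f else 0)
   - crea b k (if i = None then 0 else if l = None then crea b i (anni b j f) else if l = i then anni b j f else 0)
   + crea b k (crea b i (if j = None \<and> l \<noteq> None then - anni b l f else if j \<noteq> None \<and> l = None then anni b j f else 0))"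
    unfolding anni_crea crea_linear crea_crea[of b i k] anni_anni[of b j l] by (simp only: algebra_simps)
  \<comment> \<open>Since \<open>crea b None\<close> is minus the identity, the corrections
    involving the last index either cancel or become the delta terms still missing.\<close>
  also have "\<dots> = (if j = k then crea b i (anni b l f) else 0) - (if l = i then crea b k (anni b j f) else 0)"
    unfolding crea_crea[of b k i]
    by (cases i; cases j; cases k; cases l; simp only: crea.simps(1) crea_linear crea_crea option.simps simp_thms if_True if_False refl; simp add: shift_hom)
  finally show ?thesis .
qed

section \<open>The given action in factorised form\<close>

lemma unit_action_eq: "i \<noteq> j \<Longrightarrow> unit_action b i j f = crea b i (anni b j f)"
  by (cases i; cases j)
     (simp_all add: shift_hom shift_sum_pvar psubst_shift_two mult.assoc mult.left_commute flip: up_def down_def)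

text \<open>The diagonal operators are multiplication by h_k - b - 1 and, for the last index, by -(b
  + h_1 + ... + h_n + 1). The constants add up to -(b + 1) times the trace, which is zero, and the
  remaining part has the Cartan coordinates as coefficients. Brackets can now be computed without
  separating the Cartan part from the other matrix units.\<close>

lemma sl_action_eq:
  fixes x :: "complex^('n::finite option)^('n option)"
  assumes "x \<in> sl"
  shows "sl_action b x f = (\<Sum>i\<in>UNIV. \<Sum>j\<in>UNIV. pconst (x $ i $ j) * crea b i (anni b j f))"
proof -
  let ?g = "\<lambda>i j. pconst (x $ i $ j) * crea b i (anni b j f)"
  let ?S = "\<Sum>m\<in>UNIV. pvar m :: 'n poly_ring"
  have tr: "pconst (x $ None $ None) = - (\<Sum>k\<in>UNIV. pconst (x $ Some k $ Some k) :: 'n poly_ring)"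
  proof -
    have "x $ None $ None = - (\<Sum>k\<in>UNIV. x $ Some k $ Some k)"
      using assms by (simp add: sl_def trace_def UNIV_option_conv sum.reindex add_eq_0_iff2)
    then show ?thesis
      by (simp only: pconst_uminus pconst_sum)
  qed
  have diag: "crea b (Some k) (anni b (Some k) f) = (pvar k - pconst b - 1) * f" for k
    by (simp add: shift_inverse)
  have "(\<Sum>i\<in>UNIV. \<Sum>j\<in>UNIV. ?g i j) = (\<Sum>(i, j)\<in>UNIV. ?g i j)"
    by (simp add: sum.cartesian_product)
  also have "\<dots> = (\<Sum>(i, j)\<in>{(i, j). i \<noteq> j}. ?g i j) + (\<Sum>(i, j)\<in>{(i, j). i = j}. ?g i j)"
    by (subst sum.union_disjoint[symmetric]) (auto intro!: sum.cong)
  also have "(\<Sum>(i, j)\<in>{(i, j). i = j}. ?g i j) = (\<Sum>i\<in>UNIV. ?g i i)"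
    by (rule sum.reindex_bij_witness[of _ "\<lambda>i. (i, i)" fst]) auto
  also have "\<dots> = ?g None None + (\<Sum>k\<in>UNIV. ?g (Some k) (Some k))"
    by (simp only: UNIV_option_conv) (simp add: sum.reindex)
  \<comment> \<open>The trace relation rewrites the constant part of the last diagonal term so that
    it cancels against that of the others.\<close>
  also have "?g None None = (\<Sum>k\<in>UNIV. pconst (x $ Some k $ Some k)) * (pconst b + 1) * f - pconst (x $ None $ None) * ?S * f"
    by (simp add: tr algebra_simps)
  also have "(\<Sum>k\<in>UNIV. ?g (Some k) (Some k)) = (\<Sum>k\<in>UNIV. pconst (x $ Some k $ Some k) * pvar k * f)
      - (\<Sum>k\<in>UNIV. pconst (x $ Some k $ Some k)) * (pconst b + 1) * f"
    unfolding diag by (simp add: sum_distrib_right sum_distrib_left algebra_simps sum.distrib sum_subtractf)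
  also have "(\<Sum>(i, j)\<in>{(i, j). i \<noteq> j}. ?g i j) = (\<Sum>(i, j)\<in>{(i, j). i \<noteq> j}. pscale (x $ i $ j) (unit_action b i j f))"
    by (intro sum.cong) (auto simp: unit_action_eq pscale_def)
  finally show ?thesis
    by (simp add: sl_action_def pscale_def pconst_diff algebra_simps sum_subtractf sum_distrib_left sum_distrib_right)
qed

section \<open>Module axioms on trace-zero matrices\<close>

lemma vector_space_pscale: "vector_space pscale"
  by unfold_locales (simp_all add: pscale_def pconst_add pconst_mult algebra_simps)

lemma sl_action_linear:
  "sl_action b x (f + g) = sl_action b x f + sl_action b x g"
  "sl_action b x (pscale c f) = pscale c (sl_action b x f)" if "x \<in> sl"
  by (simp_all add: sl_action_eq[OF that] pscale_def anni_linear crea_linear sum.distrib sum_distrib_left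
      distrib_left mult.left_commute)

lemma matrix_scale_nth: "matrix_scale c x $ i $ j = c * x $ i $ j"
  by (simp add: matrix_scale_def)

lemma sl_closed: "x \<in> sl \<Longrightarrow> y \<in> sl \<Longrightarrow> x + y \<in> sl" "x \<in> sl \<Longrightarrow> matrix_scale c x \<in> sl"
  by (simp_all add: sl_def trace_def sum.distrib matrix_scale_def flip: sum_distrib_left)

lemma lie_bracket_nth:
  "lie_bracket x y $ i $ j = (\<Sum>k\<in>UNIV. x $ i $ k * y $ k $ j) - (\<Sum>k\<in>UNIV. y $ i $ k * x $ k $ j)"
  by (simp add: lie_bracket_def matrix_matrix_mult_def)

text \<open>The relation between matrix units extends bilinearly; the deltas collapse the fourfold
  sums to the entries of the two matrix products.\<close>

lemma sl_action_bracket: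
  fixes x y :: "complex^('n::finite option)^('n option)"
  assumes x: "x \<in> sl" and y: "y \<in> sl"
  shows "sl_action b (lie_bracket x y) f = sl_action b x (sl_action b y f) - sl_action b y (sl_action b x f)"
proof -
  let ?E = "\<lambda>i j f. crea b i (anni b j f)"
  let ?X = "\<lambda>i j. pconst (x $ i $ j) :: 'n poly_ring" and ?Y = "\<lambda>i j. pconst (y $ i $ j) :: 'n poly_ring"
  have comp: "sl_action b u (sl_action b v f) = (\<Sum>i\<in>UNIV. \<Sum>j\<in>UNIV. \<Sum>k\<in>UNIV. \<Sum>l\<in>UNIV.
      pconst (u $ i $ j) * (pconst (v $ k $ l) * ?E i j (?E k l f)))" if "u \<in> sl" "v \<in> sl" for u v
    unfolding sl_action_eq[OF that(1)] sl_action_eq[OF that(2)]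
    by (simp only: anni_sum crea_sum anni_linear crea_linear sum_distrib_left)
  \<comment> \<open>Exchanging the index pairs (i, j) and (k, l) aligns both composites, so their
    difference can be taken term by term.\<close>
  have comp': "sl_action b y (sl_action b x f) = (\<Sum>i\<in>UNIV. \<Sum>j\<in>UNIV. \<Sum>k\<in>UNIV. \<Sum>l\<in>UNIV.
      ?X i j * (?Y k l * ?E k l (?E i j f)))"
    unfolding comp[OF y x]
    unfolding sum.cartesian_product
    by (rule sum.reindex_bij_witness[of _ "\<lambda>(i, j, k, l). (k, l, i, j)" "\<lambda>(i, j, k, l). (k, l, i, j)"])
       (auto simp: mult.left_commute)
  have "sl_action b x (sl_action b y f) - sl_action b y (sl_action b x f) = 
      (\<Sum>i\<in>UNIV. \<Sum>j\<in>UNIV. \<Sum>k\<in>UNIV. \<Sum>l\<in>UNIV. ?X i j * (?Y k l * 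
       ((if j = k then ?E i l f else 0) - (if l = i then ?E k j f else 0))))"
    unfolding comp[OF x y] comp' crea_anni_bracket[symmetric]
    by (simp only: sum_subtractf right_diff_distrib)
  also have "\<dots> = (\<Sum>i\<in>UNIV. \<Sum>j\<in>UNIV. \<Sum>l\<in>UNIV. ?X i j * (?Y j l * ?E i l f))
      - (\<Sum>i\<in>UNIV. \<Sum>j\<in>UNIV. \<Sum>k\<in>UNIV. ?X i j * (?Y k i * ?E k j f))"
  proof -
    have "(\<Sum>k\<in>UNIV. \<Sum>l\<in>UNIV. ?X i j * (?Y k l * (if j = k then ?E i l f else 0))) =
       (\<Sum>l\<in>UNIV. ?X i j * (?Y j l * ?E i l f))" for i j
      by (subst sum.swap) (simp add: if_distrib cong: if_cong)
    moreover have "(\<Sum>k\<in>UNIV. \<Sum>l\<in>UNIV. ?X i j * (?Y k l * (if l = i then ?E k j f else 0))) =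
       (\<Sum>k\<in>UNIV. ?X i j * (?Y k i * ?E k j f))" for i j
      by (simp add: if_distrib cong: if_cong)
    ultimately show ?thesis
      by (simp only: sum_subtractf right_diff_distrib)
  qed
  also have "(\<Sum>i\<in>UNIV. \<Sum>j\<in>UNIV. \<Sum>l\<in>UNIV. ?X i j * (?Y j l * ?E i l f)) =
      (\<Sum>i\<in>UNIV. \<Sum>l\<in>UNIV. \<Sum>j\<in>UNIV. ?X i j * ?Y j l * ?E i l f)"
    by (simp only: mult.assoc) (intro sum.cong refl sum.swap)
  \<comment> \<open>Reordering makes i the inner index, so the inner sum is the (k, j) entry of the
    product of \<open>y\<close> and \<open>x\<close>.\<close>
  also have "(\<Sum>i\<in>UNIV. \<Sum>j\<in>UNIV. \<Sum>k\<in>UNIV. ?X i j * (?Y k i * ?E k j f)) =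
      (\<Sum>k\<in>UNIV. \<Sum>j\<in>UNIV. \<Sum>i\<in>UNIV. ?Y k i * ?X i j * ?E k j f)"
    unfolding sum.cartesian_product
    by (rule sum.reindex_bij_witness[of _ "\<lambda>(k, j, i). (i, j, k)" "\<lambda>(k, j, i). (i, j, k)"]) (auto simp: ac_simps)
  finally show ?thesis
    by (simp add: sl_action_eq[OF lie_bracket_in_sl] lie_bracket_nth pconst_diff pconst_sum pconst_mult
        sum_subtractf left_diff_distrib sum_distrib_right)
qed

lemma lie_module_sl_action: "lie_module sl pscale (sl_action b)"
  unfolding lie_module_def Vector_Spaces.linear_iff
  by (intro conjI ballI allI vector_space_pscale sl_action_linear sl_action_bracket)
     (simp_all add: sl_action_eq sl_closed pconst_add pconst_mult matrix_scale_nth pscale_def distrib_right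
       sum.distrib sum_distrib_left mult.assoc)

section \<open>Values of the action on the basis\<close>

lemma sl_action_matrix_unit:
  fixes i j :: "'n::finite option"
  assumes "i \<noteq> j" shows "sl_action b (matrix_unit i j) f = crea b i (anni b j f)"
proof -
  have "pconst (matrix_unit i j $ k $ l) * g = (if l = j then if k = i then g else 0 else 0)" for k l and g :: "'n poly_ring"
    by (simp add: matrix_unit_nth)
  then show ?thesis
    by (simp add: sl_action_eq[OF matrix_unit_in_sl[OF assms]])
qed

lemma sl_action_cartan_h: "sl_action b (cartan_h i) f = pvar i * f"
proof -
  have "(\<Sum>k\<in>UNIV. pscale (cartan_h i $ Some k $ Some k - cartan_h i $ None $ None) (pvar k * f)) =
     (\<Sum>k\<in>UNIV. if k = i then pvar k * f else 0)"
    by (intro sum.cong) (auto simp: cartan_h_nth pscale_def)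
  moreover have "(\<Sum>(k, j)\<in>{(k, j). k \<noteq> j}. pscale (cartan_h i $ k $ j) (unit_action b k j f)) = 0"
    by (intro sum.neutral) (auto simp: cartan_h_nth pscale_def)
  ultimately show ?thesis
    by (simp add: sl_action_def)
qed

subsection \<open>Simplicity and isomorphisms\<close>

lemma monomial_update:
  "pvar i ^ k * (\<Prod>j\<in>UNIV - {i}. pvar j ^ Poly_Mapping.lookup m j) =
     (Poly_Mapping.single (Poly_Mapping.update i k m) 1 :: 'n::finite poly_ring)"
proof -
  have "(\<Prod>j\<in>UNIV. pvar j ^ Poly_Mapping.lookup (Poly_Mapping.update i k m) j) =
      (pvar i ^ k * (\<Prod>j\<in>UNIV - {i}. pvar j ^ Poly_Mapping.lookup m j) :: 'n poly_ring)"
    by (subst prod.remove[of UNIV i]) (auto simp: lookup_update intro!: prod.cong)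
  then show ?thesis
    by (simp only: prod_pvar_power)
qed

lemma update_lookup_self: "Poly_Mapping.update i (Poly_Mapping.lookup m i) m = m"
  by (rule poly_mapping_eqI) (simp add: lookup_update)

text \<open>The binomial theorem is applied to the power of h_i + 1. The top term is the original
  monomial and cancels, hence the strict bound on \<open>k\<close>.\<close>

lemma up_single_diff:
  "up i (Poly_Mapping.single m c) - Poly_Mapping.single m c =
     (\<Sum>k<Poly_Mapping.lookup m i.
        Poly_Mapping.single (Poly_Mapping.update i k m) (c * of_nat (Poly_Mapping.lookup m i choose k)))"
proof -
  let ?n = "Poly_Mapping.lookup m i"
  have "up i (Poly_Mapping.single m c) =
      pconst c * ((pvar i + 1) ^ ?n * (\<Prod>j\<in>UNIV - {i}. pvar j ^ Poly_Mapping.lookup m j))"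
    unfolding up_def psubst_single by (subst prod.remove[of UNIV i]) auto
  also have "\<dots> = (\<Sum>k\<le>?n. pconst (c * of_nat (?n choose k)) *
      (pvar i ^ k * (\<Prod>j\<in>UNIV - {i}. pvar j ^ Poly_Mapping.lookup m j)))"
    by (simp add: binomial_ring sum_distrib_left sum_distrib_right pconst_mult mult.assoc)
       (simp add: pconst_def)
  also have "\<dots> = (\<Sum>k\<le>?n. Poly_Mapping.single (Poly_Mapping.update i k m) (c * of_nat (?n choose k)))"
    unfolding monomial_update by (simp add: pconst_def mult_single)
  finally show ?thesis
    by (simp add: update_lookup_self flip: lessThan_Suc_atMost)
qed

lemma lookup_up_diff:
  "Poly_Mapping.lookup (up i f - f) p =
     (\<Sum>m\<in>Poly_Mapping.keys f. \<Sum>k<Poly_Mapping.lookup m i.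
        if Poly_Mapping.update i k m = p
        then Poly_Mapping.lookup f m * of_nat (Poly_Mapping.lookup m i choose k) else 0)"
proof -
  have "up i f - f = (\<Sum>m\<in>Poly_Mapping.keys f.
      up i (Poly_Mapping.single m (Poly_Mapping.lookup f m)) - Poly_Mapping.single m (Poly_Mapping.lookup f m))"
    unfolding sum_subtractf up_def psubst_sum[symmetric] poly_expansion[symmetric] ..
  then show ?thesis
    unfolding up_single_diff by (simp only: lookup_sum lookup_single when_def)
qed

definition total_degree :: "('n::finite \<Rightarrow>\<^sub>0 nat) \<Rightarrow> nat" where
  "total_degree m = (\<Sum>i\<in>UNIV. Poly_Mapping.lookup m i)"

lemma total_degree_eq_0_iff: "total_degree m = 0 \<longleftrightarrow> m = 0"
  by (auto simp: total_degree_def intro: poly_mapping_eqI)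

text \<open>The additive form avoids truncated subtraction of naturals.\<close>

lemma total_degree_update: "total_degree (Poly_Mapping.update i k m) + Poly_Mapping.lookup m i = total_degree m + k"
proof -
  have "(\<Sum>j\<in>UNIV - {i}. Poly_Mapping.lookup (Poly_Mapping.update i k m) j) =
      (\<Sum>j\<in>UNIV - {i}. Poly_Mapping.lookup m j)"
    by (intro sum.cong) (auto simp: lookup_update)
  then show ?thesis
    by (simp add: total_degree_def sum.remove[of UNIV i] lookup_update)
qed

lemma keys_up_diff:
  assumes "p \<in> Poly_Mapping.keys (up i f - f)"
  shows "\<exists>m\<in>Poly_Mapping.keys f. total_degree p < total_degree m"
proof (rule ccontr)
  assume no: "\<not> ?thesis"
  have "Poly_Mapping.update i k m \<noteq> p" if "m \<in> Poly_Mapping.keys f" "k < Poly_Mapping.lookup m i" for m k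
    using no that total_degree_update[of i k m] by auto
  then have "Poly_Mapping.lookup (up i f - f) p = 0"
    unfolding lookup_up_diff by (intro sum.neutral) auto
  then show False
    using assms by (simp add: in_keys_iff)
qed

text \<open>The witness is \<open>m\<close> with its exponent at \<open>i\<close> lowered by one. By
  maximality of the degree only \<open>m\<close> itself contributes to that coefficient, and the
  contribution is the coefficient of \<open>m\<close> times its exponent at \<open>i\<close>,
  nonzero in characteristic zero.\<close>

lemma up_diff_nonzero:
  assumes m: "m \<in> Poly_Mapping.keys f" and pos: "Poly_Mapping.lookup m i > 0"
    and max: "\<And>m'. m' \<in> Poly_Mapping.keys f \<Longrightarrow> total_degree m' \<le> total_degree m"
  shows "up i f - f \<noteq> 0"
proof -
  let ?n = "Poly_Mapping.lookup m i"
  let ?p = "Poly_Mapping.update i (?n - 1) m"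
  have choose: "?n choose (?n - 1) = ?n"
    using pos by (cases ?n) simp_all
  have eq: "m' = m \<and> k = ?n - 1"
    if "m' \<in> Poly_Mapping.keys f" "k < Poly_Mapping.lookup m' i" "Poly_Mapping.update i k m' = ?p" for m' k
  proof -
    have k: "k = ?n - 1"
      using that(3) by (metis lookup_update)
    have "total_degree m' + k - Poly_Mapping.lookup m' i = total_degree m - 1"
      using total_degree_update[of i k m'] total_degree_update[of i "?n - 1" m] that(3) pos by simp
    \<comment> \<open>The exponent of \<open>m'\<close> at \<open>i\<close> exceeds
      \<open>?n - 1\<close>; a value above \<open>?n\<close> would make the degree of
      \<open>m'\<close> larger than that of \<open>m\<close>.\<close>
    then have "Poly_Mapping.lookup m' i = ?n"
      using max[OF that(1)] that(2) k pos total_degree_update[of i k m'] total_degree_update[of i "?n - 1" m] that(3) by simp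
    then have "m' = Poly_Mapping.update i ?n (Poly_Mapping.update i k m')"
      by (intro poly_mapping_eqI) (auto simp: lookup_update)
    also have "\<dots> = m"
      unfolding that(3) by (intro poly_mapping_eqI) (simp add: lookup_update)
    finally show ?thesis
      using k by simp
  qed
  have "Poly_Mapping.lookup (up i f - f) ?p = (\<Sum>m'\<in>Poly_Mapping.keys f. \<Sum>k<Poly_Mapping.lookup m' i.
      if k = ?n - 1 then if m' = m then Poly_Mapping.lookup f m * of_nat ?n else 0 else 0)"
    unfolding lookup_up_diff
  proof (intro sum.cong refl)
    fix m' k assume "m' \<in> Poly_Mapping.keys f" "k \<in> {..<Poly_Mapping.lookup m' i}"
    then show "(if Poly_Mapping.update i k m' = ?p
          then Poly_Mapping.lookup f m' * of_nat (Poly_Mapping.lookup m' i choose k) else 0) =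
        (if k = ?n - 1 then if m' = m then Poly_Mapping.lookup f m * of_nat ?n else 0 else 0)"
      using eq[of m' k] pos choose by auto
  qed
  also have "\<dots> = (\<Sum>m'\<in>Poly_Mapping.keys f. if m' = m then Poly_Mapping.lookup f m * of_nat ?n else 0)"
    using pos by (intro sum.cong refl) auto
  also have "\<dots> = Poly_Mapping.lookup f m * of_nat ?n"
    using m by simp
  also have "\<dots> \<noteq> 0"
    using m pos by (simp add: in_keys_iff)
  finally show ?thesis
    by auto
qed

text \<open>Strong induction on the largest total degree: passing to a nonzero difference lowers it
  until a nonzero constant is reached, which is then rescaled to 1.\<close>

lemma shift_closed_contains_1:
  fixes W :: "'n::finite poly_ring set"
  assumes diff: "\<And>f g. f \<in> W \<Longrightarrow> g \<in> W \<Longrightarrow> f - g \<in> W"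
    and scale: "\<And>c f. f \<in> W \<Longrightarrow> pscale c f \<in> W"
    and up: "\<And>i f. f \<in> W \<Longrightarrow> up i f \<in> W"
    and f: "f \<in> W" "f \<noteq> 0"
  shows "1 \<in> W"
proof -
  have "f \<in> W \<Longrightarrow> f \<noteq> 0 \<Longrightarrow> Max (total_degree ` Poly_Mapping.keys f) = d \<Longrightarrow> 1 \<in> W" for d and f :: "'n poly_ring"
  proof (induction d arbitrary: f rule: less_induct)
    case (less d)
    let ?D = "\<lambda>f. total_degree ` Poly_Mapping.keys f"
    have ne: "?D f \<noteq> {}"
      using less.prems(2) by simp
    then obtain m where m: "m \<in> Poly_Mapping.keys f" "total_degree m = d"
      using Max_in[of "?D f"] less.prems(3) by auto
    have max: "total_degree m' \<le> total_degree m" if "m' \<in> Poly_Mapping.keys f" for m'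
      using that less.prems(3) m by (auto intro: Max_ge)
    show ?case
    \<comment> \<open>As \<open>m\<close> has maximal degree, \<open>m = 0\<close> means that
      \<open>f\<close> is constant.\<close>
    proof (cases "m = 0")
      case True
      then have "Poly_Mapping.keys f = {0}"
        using max m by (auto simp: total_degree_eq_0_iff[THEN iffD2] total_degree_eq_0_iff)
      then obtain c where c: "f = pconst c" "c \<noteq> 0"
        using poly_expansion[of f] less.prems(2) by (auto simp: pconst_def)
      then have "pscale (1 / c) f = 1"
        by (simp add: pscale_def flip: pconst_mult)
      then show ?thesis
        using scale[OF less.prems(1)] by metis
    next
      case False
      then obtain i where i: "Poly_Mapping.lookup m i > 0"
        by (metis poly_mapping_eqI lookup_zero gr0I)
      let ?g = "up i f - f"
      have g: "?g \<noteq> 0"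
        using up_diff_nonzero[OF m(1) i max] .
      then have "Max (?D ?g) \<in> ?D ?g"
        by (intro Max_in) auto
      then have "Max (?D ?g) < d"
        using keys_up_diff max m(2) by fastforce
      then show ?thesis
        using less.IH g diff up less.prems(1) by blast
    qed
  qed
  then show ?thesis
    using f by blast
qed

lemma ideal_with_1:
  fixes W :: "'n::finite poly_ring set"
  assumes add: "\<And>f g. f \<in> W \<Longrightarrow> g \<in> W \<Longrightarrow> f + g \<in> W"
    and scale: "\<And>c f. f \<in> W \<Longrightarrow> pscale c f \<in> W"
    and var: "\<And>i f. f \<in> W \<Longrightarrow> pvar i * f \<in> W"
    and one: "1 \<in> W"
  shows "W = UNIV"
proof -
  \<comment> \<open>The multipliers that preserve \<open>W\<close> form a subring containing the
    generators. Quantifying over \<open>g\<close> inside the induction is what makes the product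
    case work.\<close>
  have "\<forall>g\<in>W. f * g \<in> W" for f :: "'n poly_ring"
    by (induction f rule: poly_ring_induct)
       (auto simp: distrib_right mult.assoc simp flip: pscale_def intro: add scale var)
  from this[of _] one have "f \<in> W" for f
    by (metis mult.right_neutral)
  then show ?thesis
    by blast
qed

section \<open>Simplicity\<close>

lemma simple_sl_action:
  "simple_lie_module sl pscale
     (sl_action b :: complex^('n::finite option)^('n option) \<Rightarrow> 'n poly_ring \<Rightarrow> 'n poly_ring)"
  unfolding simple_lie_module_def
proof (intro conjI allI impI lie_module_sl_action)
  have "(1 :: 'n poly_ring) \<noteq> 0"
    by simp
  then show "(UNIV :: 'n poly_ring set) \<noteq> {0}"
    by blast
  fix W :: "'n poly_ring set"
  assume W: "lie_submodule sl pscale (sl_action b :: complex^('n option)^('n option) \<Rightarrow> _) W"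
  interpret vector_space "pscale :: complex \<Rightarrow> 'n poly_ring \<Rightarrow> _"
    by (rule vector_space_pscale)
  have sub: "subspace W" and act: "\<And>x w. x \<in> sl \<Longrightarrow> w \<in> W \<Longrightarrow> sl_action b x w \<in> W"
    using W by (auto simp: lie_submodule_def)
  have up: "up i w \<in> W" if "w \<in> W" for i w
  proof -
    have "- up i w \<in> W"
      using act[OF matrix_unit_in_sl that, of None "Some i"] by (simp add: sl_action_matrix_unit)
    then show ?thesis
      using subspace_neg[OF sub] by fastforce
  qed
  have var: "pvar i * w \<in> W" if "w \<in> W" for i w
    using act[OF cartan_h_in_sl that] by (simp add: sl_action_cartan_h)
  show "W = {0} \<or> W = UNIV"
  proof (rule disjCI)
    assume "W \<noteq> UNIV"
    then have "1 \<notin> W"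
      using ideal_with_1[of W] var subspace_add[OF sub] subspace_scale[OF sub] by blast
    then have "W \<subseteq> {0}"
      using shift_closed_contains_1[of W] up subspace_diff[OF sub] subspace_scale[OF sub] by blast
    then show "W = {0}"
      using subspace_0[OF sub] by blast
  qed
qed

section \<open>Distinguishing the modules for different parameters\<close>

lemma not_isomorphic_sl_action:
  assumes card: "CARD('n::finite) > 1" and "b \<noteq> b'"
  shows "\<not> lie_module_isomorphic sl
     pscale (sl_action b :: complex^('n option)^('n option) \<Rightarrow> 'n poly_ring \<Rightarrow> 'n poly_ring)
     pscale (sl_action b')"
proof
  assume "lie_module_isomorphic sl
     pscale (sl_action b :: complex^('n option)^('n option) \<Rightarrow> 'n poly_ring \<Rightarrow> 'n poly_ring)
     pscale (sl_action b')"
  then obtain \<phi> :: "'n poly_ring \<Rightarrow> 'n poly_ring"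
    where lin: "Vector_Spaces.linear pscale pscale \<phi>" and "bij \<phi>"
      and act: "\<And>(x :: complex^('n option)^('n option)) v. x \<in> sl \<Longrightarrow> \<phi> (sl_action b x v) = sl_action b' x (\<phi> v)"
    by (auto simp: lie_module_isomorphic_def)
  have add: "\<phi> (f + g) = \<phi> f + \<phi> g" and scale: "\<phi> (pconst c * f) = pconst c * \<phi> f" for f g c
    using lin by (auto simp: Vector_Spaces.linear_iff pscale_def)
  have var: "\<phi> (pvar i * f) = pvar i * \<phi> f" for i f
    using act[OF cartan_h_in_sl] by (simp add: sl_action_cartan_h)
  \<comment> \<open>The multipliers commuting with \<open>\<phi>\<close> contain the generators and
    are closed under sums and products. Hence \<open>\<phi>\<close> is multiplication by
    \<open>\<phi> 1\<close>.\<close>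
  have "\<forall>g. \<phi> (f * g) = f * \<phi> g" for f
    by (induction f rule: poly_ring_induct) (simp_all add: add scale var distrib_right mult.assoc)
  then have mult: "\<phi> f = f * \<phi> 1" for f
    by (metis mult.right_neutral)
  have up: "up i (\<phi> 1) = \<phi> 1" for i
  proof -
    have "\<phi> (- 1) = - up i (\<phi> 1)"
      using act[OF matrix_unit_in_sl, of None "Some i" 1] by (simp add: sl_action_matrix_unit shift_hom)
    then show ?thesis
      using mult[of "- 1"] by simp
  qed
  then have down: "down i (\<phi> 1) = \<phi> 1" for i
    by (metis shift_inverse(2))
  \<comment> \<open>Here n > 1 enters: a matrix unit off the diagonal that avoids the last index has
    to exist.\<close>
  obtain i j :: 'n where "i \<noteq> j"
    using card by (metis card_le_Suc0_iff_eq finite_code One_nat_def not_less UNIV_I)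
  then have "\<phi> (pvar i - pconst b - 1) = (pvar i - pconst b' - 1) * \<phi> 1"
    using act[OF matrix_unit_in_sl, of "Some i" "Some j" 1]
    by (simp add: sl_action_matrix_unit shift_hom up down)
  then have "(pvar i - pconst b - 1) * \<phi> 1 = (pvar i - pconst b' - 1) * \<phi> 1"
    using mult[of "pvar i - pconst b - 1"] by metis
  then have "pconst (b' - b) * \<phi> 1 = 0"
    by (simp add: pconst_diff algebra_simps)
  \<comment> \<open>Only the nonzero constant b' - b has to be inverted.\<close>
  then have "pconst (1 / (b' - b)) * (pconst (b' - b) * \<phi> 1) = 0"
    by simp
  then have "\<phi> 1 = 0"
    using \<open>b \<noteq> b'\<close> by (simp flip: mult.assoc pconst_mult)
  then have "\<phi> 1 = \<phi> 0"
    using mult[of 0] by simp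
  then show False
    using \<open>bij \<phi>\<close> by (metis bij_is_inj injD zero_neq_one)
qed

theorem theorem2:
  shows "(\<forall>b.
        (\<forall>(i :: 'n::finite) f. sl_action b (cartan_h i) f = pvar i * f) \<and>
        (\<forall>(i :: 'n) f. sl_action b (matrix_unit (Some i) None) f =
           (pconst b + (\<Sum>m\<in>UNIV. pvar m)) * (pvar i - pconst b - 1) *
             psubst (pvar(i := pvar i - 1)) f) \<and>
        (\<forall>(j :: 'n) f. sl_action b (matrix_unit None (Some j)) f =
           - psubst (pvar(j := pvar j + 1)) f) \<and>
        (\<forall>(i :: 'n) j f. i \<noteq> j \<longrightarrow> sl_action b (matrix_unit (Some i) (Some j)) f =
           (pvar i - pconst b - 1) * psubst (pvar(i := pvar i - 1, j := pvar j + 1)) f) \<and>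
        simple_lie_module sl pscale
          (sl_action b :: complex^('n option)^('n option) \<Rightarrow> 'n poly_ring \<Rightarrow> 'n poly_ring)) \<and>
     (CARD('n) > 1 \<longrightarrow>
        (\<forall>b b'. b \<noteq> b' \<longrightarrow>
           \<not> lie_module_isomorphic sl
              pscale (sl_action b :: complex^('n option)^('n option) \<Rightarrow> 'n poly_ring \<Rightarrow> 'n poly_ring)
              pscale (sl_action b')))"
proof -
  \<comment> \<open>Off the diagonal the action reduces to \<open>unit_action\<close>, whose
    defining equations are the prescribed formulas.\<close>
  have unit: "sl_action b (matrix_unit i j) f = unit_action b i j f" if "i \<noteq> j"
    for b f and i j :: "'n option"
    using that by (simp add: sl_action_matrix_unit unit_action_eq)
  show ?thesis
    by (intro conjI allI impI sl_action_cartan_h simple_sl_action not_isomorphic_sl_action)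
       (simp_all add: unit)
qed

end
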